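(* There exists a (closed) subspace $Z$ of $\ell_\infty^c(\omega_1)$ with an unconditional basis such that $Z$ does not embed into $\ell_\infty$ and $c_0(\omega_1)$ does not embed into $Z$. Moreover, $Z$ contains an isomorphic copy of $\ell_1(\omega_1)$ and there is an injective bounded linear operator from $Z$ into $\ell_\infty$.
   Context: $\omega_1$ is the first uncountable ordinal. $\ell_\infty^c(\omega_1)$ denotes the Banach space of all bounded scalar-valued functions on $\omega_1$ that are non-zero at no more than countably many points, with the supremum norm. $\ell_\infty$ is the space of bounded scalar sequences with the supremum norm. $c_0(\omega_1)$ is the Banach space of scalar functions $f$ on $\omega_1$ such that $\{\alpha : |f(\alpha)|\geq \varepsilon\}$ is finite for every $\varepsilon>0$, with the supremum norm. $\ell_1(\omega_1)$ is the Banach space of absolutely summable scalar functions on $\omega_1$ with the norm $\|f\|=\sum_{\alpha}|f(\alpha)|$. Subspaces of Banach spaces are closed linear subspaces. A Banach space $X$ embeds into a Banach space $Y$ (equivalently, $Y$ contains an isomorphic copy of $X$) if there is a bounded linear operator $T\colon X\to Y$ and a constant $c>0$ with $\|Tx\|\geq c\|x\|$ for all $x\in X$. An unconditional basis is allowed to be uncountable: a family $(z_i)_{i\in I}$ in a Banach space $Z$ is an unconditional basis if every $z\in Z$ has a unique representation $z=\sum_{i\in I} a_i z_i$ with scalars $a_i$, the sum converging unconditionally in norm (i.e. the net of sums over finite subsets of $I$, directed by inclusion, converges to $z$). *)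

theory Defs
  imports "HOL-Analysis.Analysis" "HOL-Library.Countable_Set_Type"
begin

text \<open>
  The first uncountable ordinal, as the field of the initial well-order \<^term>\<open>cardSuc natLeq\<close>;
  the lemmas \<open>uncountable_omega1\<close> and \<open>countable_initial_segment_omega1\<close> below characterise
  its order type.
\<close>

typedef omega1 = "Field (cardSuc natLeq)"
proof -
  have "infinite (Field (cardSuc natLeq))"
    using cardSuc_finite[OF natLeq_Card_order] by (simp add: Field_natLeq)
  then show ?thesis
    using finite.emptyI by (metis all_not_in_conv)
qed

lemma well_order_cardSuc_natLeq: "Well_order (cardSuc natLeq)"
  using cardSuc_Card_order[OF natLeq_Card_order] by (rule card_order_on_well_order_on)

instantiation omega1 :: wellorder
begin

definition less_eq_omega1 :: "omega1 \<Rightarrow> omega1 \<Rightarrow> bool" where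
  "a \<le> b \<longleftrightarrow> (Rep_omega1 a, Rep_omega1 b) \<in> cardSuc natLeq"

definition less_omega1 :: "omega1 \<Rightarrow> omega1 \<Rightarrow> bool" where
  "a < b \<longleftrightarrow> a \<le> b \<and> \<not> b \<le> (a :: omega1)"

instance
proof
  note wo = well_order_cardSuc_natLeq
  have refl: "refl_on (Field (cardSuc natLeq)) (cardSuc natLeq)"
    and trans: "trans (cardSuc natLeq)" and antisym: "antisym (cardSuc natLeq)"
    and total: "total_on (Field (cardSuc natLeq)) (cardSuc natLeq)"
    and wf: "wf (cardSuc natLeq - Id)"
    using wo by (auto simp: order_on_defs)
  fix a b c :: omega1
  show "(a < b) = (a \<le> b \<and> \<not> b \<le> a)" by (simp add: less_omega1_def)
  show "a \<le> a" using refl Rep_omega1[of a] by (simp add: less_eq_omega1_def refl_on_def)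
  show "a \<le> c" if "a \<le> b" "b \<le> c"
    using that transD[OF trans] by (auto simp: less_eq_omega1_def)
  show "x = y" if "x \<le> y" "y \<le> x" for x y :: omega1
    using that antisymD[OF antisym] Rep_omega1_inject by (metis less_eq_omega1_def)
  show "a \<le> b \<or> b \<le> a"
    using total refl Rep_omega1[of a] Rep_omega1[of b]
    unfolding less_eq_omega1_def total_on_def refl_on_def by metis
  have "(x, y) \<in> inv_image (cardSuc natLeq - Id) Rep_omega1" if "x < y" for x y
    using that by (auto simp: inv_image_def less_omega1_def less_eq_omega1_def)
  then have "wf {(x, y :: omega1). x < y}"
    by (intro wf_subset[OF wf_inv_image[OF wf, of Rep_omega1]]) auto
  then show "P a" if "\<And>x. (\<And>y. y < x \<Longrightarrow> P y) \<Longrightarrow> P x" for P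
    using that by (induction a rule: wf_induct_rule) auto
qed

end

lemma uncountable_omega1:
  includes cardinal_syntax
  shows "uncountable (UNIV :: omega1 set)"
proof
  assume "countable (UNIV :: omega1 set)"
  then have "countable (range Rep_omega1)" by simp
  then have "countable (Field (cardSuc natLeq))"
    using type_definition.Rep_range[OF type_definition_omega1] by simp
  then have "|Field (cardSuc natLeq)| \<le>o natLeq"
    by (simp add: countable_card_le_natLeq)
  moreover have "|Field (cardSuc natLeq)| =o cardSuc natLeq"
    by (rule card_of_Field_ordIso[OF cardSuc_Card_order[OF natLeq_Card_order]])
  ultimately have "cardSuc natLeq \<le>o natLeq"
    using ordIso_ordLeq_trans ordIso_symmetric by blast
  then show False
    using cardSuc_greater[OF natLeq_Card_order] not_ordLess_ordLeq by blast
qed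

lemma countable_initial_segment_omega1:
  includes cardinal_syntax
  shows "countable {..<a :: omega1}"
proof -
  let ?U = "underS (cardSuc natLeq) (Rep_omega1 a)"
  have "|?U| <o cardSuc natLeq"
    by (rule card_of_underS[OF cardSuc_Card_order[OF natLeq_Card_order] Rep_omega1])
  then have "|?U| \<le>o natLeq"
    using cardSuc_ordLeq_ordLess[OF natLeq_Card_order card_of_Card_order] by blast
  then have "countable ?U" by (simp add: countable_card_le_natLeq)
  moreover have "Rep_omega1 ` {..<a} \<subseteq> ?U"
    by (auto simp: underS_def less_omega1_def less_eq_omega1_def)
  ultimately have "countable (Rep_omega1 ` {..<a})" by (rule countable_subset[rotated])
  then show ?thesis
    by (rule countable_image_inj_on) (simp add: inj_on_def Rep_omega1_inject)
qed

text \<open>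
  All the Banach spaces involved are spaces of scalar functions on an index type with pointwise
  operations. Such a space is given by its carrier \<open>X\<close> and a norm \<open>N\<close>, of which only the values
  on the carrier matter. The scalar type is meant to be \<^typ>\<open>real\<close> or \<^typ>\<open>complex\<close>, and
  linearity is always over the scalar type.
\<close>

definition sup_norm :: "('i \<Rightarrow> 'k::real_normed_field) \<Rightarrow> real" where
  "sup_norm f = (SUP i. norm (f i))"

definition l1_norm :: "('i \<Rightarrow> 'k::real_normed_field) \<Rightarrow> real" where
  "l1_norm f = (\<Sum>\<^sub>\<infinity>i. norm (f i))"

definition linf_space :: "('i \<Rightarrow> 'k::real_normed_field) set" where
  "linf_space = {f. bounded (range f)}"

definition linf_c_space :: "('i \<Rightarrow> 'k::real_normed_field) set" where
  "linf_c_space = {f. bounded (range f) \<and> countable {i. f i \<noteq> 0}}"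

definition c0_space :: "('i \<Rightarrow> 'k::real_normed_field) set" where
  "c0_space = {f. \<forall>\<epsilon>>0. finite {i. norm (f i) \<ge> \<epsilon>}}"

definition l1_space :: "('i \<Rightarrow> 'k::real_normed_field) set" where
  "l1_space = {f. (\<lambda>i. norm (f i)) summable_on UNIV}"

definition closed_subspace_of ::
  "('i \<Rightarrow> 'k::real_normed_field) set \<Rightarrow> ('i \<Rightarrow> 'k) set \<Rightarrow> (('i \<Rightarrow> 'k) \<Rightarrow> real) \<Rightarrow> bool" where
  "closed_subspace_of Z X N \<longleftrightarrow>
     Z \<subseteq> X \<and>
     (\<lambda>i. 0) \<in> Z \<and>
     (\<forall>f\<in>Z. \<forall>g\<in>Z. (\<lambda>i. f i + g i) \<in> Z) \<and>
     (\<forall>c. \<forall>f\<in>Z. (\<lambda>i. c * f i) \<in> Z) \<and>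
     (\<forall>s f. (\<forall>n::nat. s n \<in> Z) \<and> f \<in> X \<and> (\<lambda>n. N (\<lambda>i. s n i - f i)) \<longlonglongrightarrow> 0 \<longrightarrow> f \<in> Z)"

definition bounded_linear_operator ::
  "('i \<Rightarrow> 'k::real_normed_field) set \<Rightarrow> (('i \<Rightarrow> 'k) \<Rightarrow> real) \<Rightarrow>
   ('j \<Rightarrow> 'k) set \<Rightarrow> (('j \<Rightarrow> 'k) \<Rightarrow> real) \<Rightarrow> (('i \<Rightarrow> 'k) \<Rightarrow> ('j \<Rightarrow> 'k)) \<Rightarrow> bool" where
  "bounded_linear_operator X N Y M T \<longleftrightarrow>
     (\<forall>f\<in>X. T f \<in> Y) \<and>
     (\<forall>f\<in>X. \<forall>g\<in>X. T (\<lambda>i. f i + g i) = (\<lambda>j. T f j + T g j)) \<and>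
     (\<forall>c. \<forall>f\<in>X. T (\<lambda>i. c * f i) = (\<lambda>j. c * T f j)) \<and>
     (\<exists>C. \<forall>f\<in>X. M (T f) \<le> C * N f)"

definition embeds ::
  "('i \<Rightarrow> 'k::real_normed_field) set \<Rightarrow> (('i \<Rightarrow> 'k) \<Rightarrow> real) \<Rightarrow>
   ('j \<Rightarrow> 'k) set \<Rightarrow> (('j \<Rightarrow> 'k) \<Rightarrow> real) \<Rightarrow> bool" where
  "embeds X N Y M \<longleftrightarrow>
     (\<exists>T. bounded_linear_operator X N Y M T \<and> (\<exists>c>0. \<forall>f\<in>X. M (T f) \<ge> c * N f))"

definition represents ::
  "(('i \<Rightarrow> 'k::real_normed_field) \<Rightarrow> real) \<Rightarrow> 'b set \<Rightarrow> ('b \<Rightarrow> 'i \<Rightarrow> 'k) \<Rightarrow>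
   ('b \<Rightarrow> 'k) \<Rightarrow> ('i \<Rightarrow> 'k) \<Rightarrow> bool" where
  "represents N I z a f \<longleftrightarrow>
     ((\<lambda>F. N (\<lambda>i. (\<Sum>b\<in>F. a b * z b i) - f i)) \<longlongrightarrow> 0) (finite_subsets_at_top I)"

definition unconditional_basis ::
  "('i \<Rightarrow> 'k::real_normed_field) set \<Rightarrow> (('i \<Rightarrow> 'k) \<Rightarrow> real) \<Rightarrow>
   'b set \<Rightarrow> ('b \<Rightarrow> 'i \<Rightarrow> 'k) \<Rightarrow> bool" where
  "unconditional_basis Z N I z \<longleftrightarrow>
     (\<forall>b\<in>I. z b \<in> Z) \<and>
     (\<forall>f\<in>Z. \<exists>a. represents N I z a f \<and>
        (\<forall>a'. represents N I z a' f \<longrightarrow> (\<forall>b\<in>I. a' b = a b)))"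

text \<open>
  Uniqueness of representations makes an unconditional basis an injective family, so it can be
  re-indexed by a set of vectors; taking the index type to be that of the vectors
  therefore loses no generality.
\<close>

definition has_unconditional_basis ::
  "('i \<Rightarrow> 'k::real_normed_field) set \<Rightarrow> (('i \<Rightarrow> 'k) \<Rightarrow> real) \<Rightarrow> bool" where
  "has_unconditional_basis Z N \<longleftrightarrow>
     (\<exists>(I :: ('i \<Rightarrow> 'k) set) z. unconditional_basis Z N I z)"

end

theory Submission
  imports Defs
begin

text \<open>
  The space is the closed span of the unit vectors indexed by \<open>(\<alpha>, n) \<in> \<omega>\<^sub>1 \<times> \<nat>\<close> for the norm
  \<open>max (sup \<bar>x (\<alpha>, n)\<bar>) (sup\<^sub>n (\<Sum>\<alpha>. \<bar>x (\<alpha>, n)\<bar>) / (n + 1))\<close>.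
  The \<open>\<ell>\<^sub>1\<close>-part of each block is computed, up to a constant, by countably many functionals,
  namely the sums of the \<open>x (\<alpha>, n)\<close> over those \<open>\<alpha>\<close> with \<open>k \<in> S\<^sub>\<alpha>\<close>, where \<open>S\<^sub>\<alpha> \<subseteq> \<nat>\<close> for \<open>\<alpha> < \<omega>\<^sub>1\<close> is an
  independent family and \<open>k\<close> ranges over \<open>\<nat>\<close>. So all
  but countably many of the norming functionals are evaluations at single basis vectors,
  which puts the space into \<open>\<ell>\<^sub>\<infinity>\<^sup>c(\<omega>\<^sub>1)\<close>, and the countably many remaining ones separate points,
  which gives the injection into \<open>\<ell>\<^sub>\<infinity>\<close>. As \<open>c\<^sub>0(\<omega>\<^sub>1)\<close> does not inject into \<open>\<ell>\<^sub>\<infinity>\<close>, it does not embed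
  into the space. Every bounded functional is at most \<open>C / (n + 1)\<close> on all but finitely many
  basis vectors of the \<open>n\<close>-th block, so no countable set of functionals is norming up to a
  constant, and the space does not embed into \<open>\<ell>\<^sub>\<infinity>\<close>. The \<open>0\<close>-th block is \<open>\<ell>\<^sub>1(\<omega>\<^sub>1)\<close>.
\<close>

section \<open>The supremum norm\<close>

lemma norm_le_sup_norm:
  assumes "bounded (range f)"
  shows "norm (f i) \<le> sup_norm f"
proof -
  obtain B where "\<And>i. norm (f i) \<le> B"
    using assms by (auto simp: bounded_iff)
  then have "bdd_above (range (\<lambda>i. norm (f i)))"
    by (auto simp: bdd_above_def)
  then show ?thesis
    unfolding sup_norm_def by (rule cSUP_upper[rotated]) simp
qed

lemma sup_norm_le:
  assumes "\<And>i. norm (f i) \<le> B"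
  shows "sup_norm f \<le> B"
  unfolding sup_norm_def using assms by (intro cSUP_least) auto

lemma bounded_rangeI:
  assumes "\<And>i. norm (f i) \<le> B"
  shows "bounded (range f)"
  using assms by (auto simp: bounded_iff)

lemma sup_norm_nonneg:
  assumes "bounded (range f)"
  shows "0 \<le> sup_norm f"
  using norm_le_sup_norm[OF assms] norm_ge_zero order_trans by blast

lemma bounded_linear_combination:
  assumes "\<And>b. bounded (range (z b))"
  shows "bounded (range (\<lambda>i. \<Sum>b\<in>F. a b * z b i :: 'k::real_normed_field))"
proof (rule bounded_rangeI)
  show "norm (\<Sum>b\<in>F. a b * z b i) \<le> (\<Sum>b\<in>F. norm (a b) * sup_norm (z b))" for i
    by (intro sum_norm_le) (simp add: norm_mult mult_left_mono norm_le_sup_norm[OF assms])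
qed

lemma bounded_diff_functions:
  assumes "bounded (range f)" "bounded (range g)"
  shows "bounded (range (\<lambda>i. f i - g i :: 'k::real_normed_field))"
proof (rule bounded_rangeI)
  show "norm (f i - g i) \<le> sup_norm f + sup_norm g" for i
    using norm_triangle_ineq4[of "f i" "g i"] norm_le_sup_norm[OF assms(1), of i]
      norm_le_sup_norm[OF assms(2), of i] by linarith
qed

text \<open>For bounded functions a bound on the supremum and a uniform pointwise bound are
  interchangeable; returning from \<open>\<le>\<close> to \<open><\<close> costs half of
  \<open>e\<close>. Membership in \<open>Z\<close> and uniqueness of coefficients are later checked
  in this pointwise form.\<close>

lemma represents_sup_norm_iff:
  assumes "bounded (range f)" "\<And>b. bounded (range (z b))"
  shows "represents sup_norm UNIV z a f \<longleftrightarrow>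
    (\<forall>e>0. \<exists>F0. finite F0 \<and> (\<forall>F. finite F \<and> F0 \<subseteq> F \<longrightarrow>
      (\<forall>i. norm ((\<Sum>b\<in>F. a b * z b i) - f i) \<le> e)))"
    (is "_ \<longleftrightarrow> (\<forall>e>0. ?P e)")
proof -
  define d where "d F i = (\<Sum>b\<in>F. a b * z b i) - f i" for F i
  have bd: "bounded (range (d F))" for F
    unfolding d_def by (intro bounded_diff_functions bounded_linear_combination assms)
  have "represents sup_norm UNIV z a f \<longleftrightarrow>
      (\<forall>e>0. \<exists>F0. finite F0 \<and> (\<forall>F. finite F \<and> F0 \<subseteq> F \<longrightarrow> sup_norm (d F) < e))"
    unfolding represents_def tendsto_iff eventually_finite_subsets_at_top d_def[symmetric]
    using sup_norm_nonneg[OF bd] by simp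
  also have "\<dots> \<longleftrightarrow> (\<forall>e>0. \<exists>F0. finite F0 \<and> (\<forall>F. finite F \<and> F0 \<subseteq> F \<longrightarrow> (\<forall>i. norm (d F i) \<le> e)))"
    (is "?L = ?R")
  proof
    assume ?L
    then show ?R
      using norm_le_sup_norm[OF bd] by (meson less_imp_le order_trans)
  next
    assume R: ?R
    show ?L
    proof (intro allI impI)
      fix e :: real assume "e > 0"
      then obtain F0 where F0: "finite F0" "\<And>F i. finite F \<Longrightarrow> F0 \<subseteq> F \<Longrightarrow> norm (d F i) \<le> e/2"
        using R half_gt_zero by meson
      have "sup_norm (d F) < e" if "finite F" "F0 \<subseteq> F" for F
        using sup_norm_le[of "d F" "e/2"] F0(2)[OF that] \<open>e > 0\<close> by auto
      with F0(1) show "\<exists>F0. finite F0 \<and> (\<forall>F. finite F \<and> F0 \<subseteq> F \<longrightarrow> sup_norm (d F) < e)"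
        by blast
    qed
  qed
  finally show ?thesis
    by (simp add: d_def)
qed

text \<open>The definition asks for an index set of vectors, so an injective family is re-indexed by
  its own range: the image map carries the filter of finite index sets to that of finite subsets of
  the range.\<close>

lemma has_unconditional_basisI:
  assumes "inj z" "unconditional_basis Z N UNIV z"
  shows "has_unconditional_basis Z N"
proof -
  have rep: "represents N (range z) id a f \<longleftrightarrow> represents N UNIV z (a \<circ> z) f" for a f
  proof -
    have "inj_on z F" for F
      using assms(1) inj_on_subset by blast
    then have fm: "filtermap ((`) z) (finite_subsets_at_top UNIV) = finite_subsets_at_top (range z)"
      by (intro filtermap_image_finite_subsets_at_top)
    then show ?thesis
      unfolding represents_def fm[symmetric] filterlim_filtermap
      by (simp add: sum.reindex \<open>\<And>F. inj_on z F\<close>)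
  qed
  have "unconditional_basis Z N (range z) id"
    unfolding unconditional_basis_def
  proof (intro conjI ballI)
    fix b assume "b \<in> range z"
    then show "id b \<in> Z" using assms(2) by (auto simp: unconditional_basis_def)
  next
    fix f assume "f \<in> Z"
    then obtain a where a: "represents N UNIV z a f"
      "\<And>a'. represents N UNIV z a' f \<Longrightarrow> a' = a"
      using assms(2) unfolding unconditional_basis_def by blast
    have "(a \<circ> inv z) \<circ> z = a"
      using assms(1) by (simp add: fun_eq_iff)
    with a show "\<exists>a. represents N (range z) id a f \<and>
        (\<forall>a'. represents N (range z) id a' f \<longrightarrow> (\<forall>b\<in>range z. a' b = a b))"
      unfolding rep by (intro exI[of _ "a \<circ> inv z"]) (auto simp: fun_eq_iff assms(1))
  qed
  then show ?thesis
    unfolding has_unconditional_basis_def by blast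
qed

section \<open>Operators into spaces of bounded sequences\<close>

lemma bounded_linear_operatorD:
  assumes "bounded_linear_operator X N Y M T"
  shows "f \<in> X \<Longrightarrow> T f \<in> Y"
    and "f \<in> X \<Longrightarrow> g \<in> X \<Longrightarrow> T (\<lambda>i. f i + g i) = (\<lambda>j. T f j + T g j)"
    and "f \<in> X \<Longrightarrow> T (\<lambda>i. c * f i) = (\<lambda>j. c * T f j)"
    and "\<exists>C. \<forall>f\<in>X. M (T f) \<le> C * N f"
  using assms unfolding bounded_linear_operator_def by blast+

text \<open>Membership in \<open>X\<close> is proved together with the formula because additivity of
  \<open>T\<close> is available only on \<open>X\<close>. For infinite \<open>F\<close> both sums
  are 0 by convention.\<close>

lemma bounded_linear_operator_sum:
  assumes T: "bounded_linear_operator X N Y M T"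
    and X: "(\<lambda>i. 0) \<in> X" "\<And>f g. f \<in> X \<Longrightarrow> g \<in> X \<Longrightarrow> (\<lambda>i. f i + g i) \<in> X"
      "\<And>c f. f \<in> X \<Longrightarrow> (\<lambda>i. c * f i) \<in> X"
    and z: "\<And>b. b \<in> F \<Longrightarrow> z b \<in> X"
  shows "(\<lambda>i. \<Sum>b\<in>F. a b * z b i) \<in> X \<and>
    T (\<lambda>i. \<Sum>b\<in>F. a b * z b i) = (\<lambda>j. \<Sum>b\<in>F. a b * T (z b) j)"
  using z
proof (induction F rule: infinite_finite_induct)
  case (insert x F)
  have "T (\<lambda>i. a x * z x i + (\<Sum>b\<in>F. a b * z b i)) =
      (\<lambda>j. a x * T (z x) j + (\<Sum>b\<in>F. a b * T (z b) j))"
    using insert by (subst bounded_linear_operatorD(2)[OF T])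
      (auto simp: bounded_linear_operatorD(3)[OF T] X(3))
  then show ?case
    using insert X by simp
next
  case empty
  then show ?case
    using X(1) bounded_linear_operatorD(3)[OF T X(1), of 0] by simp
next
  case (infinite F)
  then show ?case
    using X(1) bounded_linear_operatorD(3)[OF T X(1), of 0] by simp
qed

text \<open>\<open>N\<close> values of norm above \<open>C / N\<close>, turned nonnegative by
  factors of norm at most one, would add up to more than \<open>C\<close>. The bound is asked only
  for sets of exactly \<open>N\<close> elements, because in a block of \<open>Z\<close> only sums of
  limited length stay in the unit ball.\<close>

lemma finite_large_values:
  fixes t :: "'a \<Rightarrow> 'k::real_normed_field"
  assumes "N > 0"
    and bound: "\<And>F u. finite F \<Longrightarrow> card F = N \<Longrightarrow> (\<And>x. norm (u x) \<le> 1) \<Longrightarrow> norm (\<Sum>x\<in>F. u x * t x) \<le> C"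
  shows "finite {x. norm (t x) > C / real N}"
proof (rule ccontr)
  assume "infinite {x. norm (t x) > C / real N}"
  then obtain F where F: "finite F" "card F = N" "F \<subseteq> {x. norm (t x) > C / real N}"
    using infinite_arbitrarily_large by blast
  define u where "u x = (if t x = 0 then 0 else of_real (norm (t x)) / t x)" for x
  have "(\<Sum>x\<in>F. u x * t x) = of_real (\<Sum>x\<in>F. norm (t x))"
    by (auto simp: u_def intro!: sum.cong)
  then have "norm (\<Sum>x\<in>F. u x * t x) = (\<Sum>x\<in>F. norm (t x))"
    by (simp only: norm_of_real) (simp add: sum_nonneg)
  moreover have "norm (\<Sum>x\<in>F. u x * t x) \<le> C"
    using F by (intro bound) (auto simp: u_def norm_divide)
  moreover have "(\<Sum>x\<in>F. norm (t x)) > (\<Sum>x\<in>F. C / real N)"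
    using F assms(1) by (intro sum_strict_mono) auto
  ultimately show False
    using F(2) assms(1) by simp
qed

section \<open>The space \<open>c0_space\<close> and its operators into bounded sequences\<close>

lemma c0_space_subspace:
  "(\<lambda>i. 0) \<in> c0_space"
  "f \<in> c0_space \<Longrightarrow> g \<in> c0_space \<Longrightarrow> (\<lambda>i. f i + g i) \<in> c0_space"
  "f \<in> c0_space \<Longrightarrow> (\<lambda>i. c * f i) \<in> c0_space"
proof -
  show "(\<lambda>i. 0) \<in> c0_space" by (simp add: c0_space_def)
next
  assume "f \<in> c0_space" "g \<in> c0_space"
  show "(\<lambda>i. f i + g i) \<in> c0_space"
    unfolding c0_space_def
  proof (intro CollectI allI impI)
    fix e :: real assume "e > 0"
    then have "e/2 > 0" by simp
    then have "finite ({i. norm (f i) \<ge> e/2} \<union> {i. norm (g i) \<ge> e/2})"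
      using \<open>f \<in> c0_space\<close> \<open>g \<in> c0_space\<close> unfolding c0_space_def by blast
    moreover have "{i. norm (f i + g i) \<ge> e} \<subseteq> {i. norm (f i) \<ge> e/2} \<union> {i. norm (g i) \<ge> e/2}"
    proof
      fix i assume "i \<in> {i. norm (f i + g i) \<ge> e}"
      then show "i \<in> {i. norm (f i) \<ge> e/2} \<union> {i. norm (g i) \<ge> e/2}"
        using norm_triangle_ineq[of "f i" "g i"] by auto
    qed
    ultimately show "finite {i. norm (f i + g i) \<ge> e}"
      by (rule finite_subset[rotated])
  qed
next
  assume f: "f \<in> c0_space"
  show "(\<lambda>i. c * f i) \<in> c0_space"
  proof (cases "c = 0")
    case False
    then have "{i. norm (c * f i) \<ge> e} = {i. norm (f i) \<ge> e / norm c}" for e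
      by (auto simp: norm_mult field_simps)
    then show ?thesis
      using f False by (simp add: c0_space_def)
  qed (simp add: c0_space_def)
qed

lemma c0_space_bounded:
  assumes "f \<in> c0_space"
  shows "bounded (range f)"
proof -
  have "finite {i. norm (f i) \<ge> 1}"
    using assms by (simp add: c0_space_def)
  then have "bounded (f ` {i. norm (f i) \<ge> 1})"
    by (intro finite_imp_bounded) simp
  then have "bounded (f ` {i. norm (f i) \<ge> 1} \<union> cball 0 1)" by simp
  then show ?thesis
    by (rule bounded_subset) force
qed

text \<open>
  Each coordinate of such an operator is a functional on \<open>c\<^sub>0\<close>, hence sees only countably many
  unit vectors.
\<close>

lemma no_injective_operator_c0_linf:
  fixes T :: "('i \<Rightarrow> 'k::real_normed_field) \<Rightarrow> nat \<Rightarrow> 'k"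
  assumes unc: "uncountable (UNIV :: 'i set)"
    and T: "bounded_linear_operator c0_space sup_norm linf_space sup_norm T"
  shows "\<not> inj_on T c0_space"
proof
  assume inj: "inj_on T c0_space"
  define e where "e x i = (if i = x then 1 else 0 :: 'k)" for x i :: 'i
  have e: "e x \<in> c0_space" for x
  proof -
    have "{i. norm (e x i) \<ge> \<epsilon>} \<subseteq> {x}" if "\<epsilon> > 0" for \<epsilon>
      using that by (auto simp: e_def)
    then show ?thesis
      unfolding c0_space_def using finite_subset by blast
  qed
  obtain C0 where C0: "\<And>f. f \<in> c0_space \<Longrightarrow> sup_norm (T f) \<le> C0 * sup_norm f"
    using T unfolding bounded_linear_operator_def by blast
  \<comment> \<open>\<open>C0\<close> comes without a sign; cutting it off at 0 allows
    \<open>mult_mono\<close> below.\<close>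
  define C where "C = max C0 0"
  have comb: "norm (\<Sum>x\<in>F. u x * T (e x) k) \<le> C"
    if "finite F" "\<And>x. norm (u x) \<le> 1" for F u k
  proof -
    let ?f = "\<lambda>i. \<Sum>x\<in>F. u x * e x i"
    have f: "?f \<in> c0_space" "T ?f = (\<lambda>j. \<Sum>x\<in>F. u x * T (e x) j)"
      using bounded_linear_operator_sum[OF T c0_space_subspace, where F = F and a = u and z = e] e
      by blast+
    have fi: "norm (?f i) \<le> 1" for i
    proof -
      have "?f i = (if i \<in> F then u i else 0)"
        using that(1) by (simp add: e_def if_distrib cong: if_cong)
      then show ?thesis using that(2) by simp
    qed
    have "bounded (range (T ?f))"
      using T f(1) unfolding bounded_linear_operator_def linf_space_def by blast
    then have "norm (T ?f k) \<le> sup_norm (T ?f)"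
      by (rule norm_le_sup_norm)
    also have "\<dots> \<le> C0 * sup_norm ?f" by (rule C0[OF f(1)])
    also have "\<dots> \<le> C * 1"
      using sup_norm_le[of ?f 1] fi sup_norm_nonneg[OF bounded_rangeI, of ?f 1]
      by (intro mult_mono) (auto simp: C_def)
    finally show ?thesis by (simp add: f(2))
  qed
  have "finite {x. norm (T (e x) k) > C / real (Suc n)}" for k n
    by (rule finite_large_values) (auto intro: comb)
  then have "countable (\<Union>k n. {x. norm (T (e x) k) > C / real (Suc n)})"
    by (intro countable_UN countableI_type countable_finite)
  \<comment> \<open>Countably many finite sets do not cover an uncountable type, so one unit vector
    is small under every coordinate \<open>k\<close> and for every \<open>n\<close> at once.\<close>
  then obtain x where x: "\<And>k n. norm (T (e x) k) \<le> C / real (Suc n)"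
    using unc by (metis (mono_tags, lifting) UNIV_I UNIV_eq_I UN_I mem_Collect_eq not_le)
  have "T (e x) k = 0" for k
  proof -
    have "(\<lambda>n. C / real (Suc n)) \<longlonglongrightarrow> 0"
      by (rule LIMSEQ_Suc[OF lim_const_over_n])
    then have "norm (T (e x) k) \<le> 0"
      by (rule LIMSEQ_le_const) (use x in auto)
    then show ?thesis by simp
  qed
  moreover have "T (\<lambda>i. 0) = (\<lambda>k. 0)"
    using bounded_linear_operatorD(3)[OF T c0_space_subspace(1), of 0] by simp
  ultimately have "T (e x) = T (\<lambda>i. 0)" by auto
  then have "e x = (\<lambda>i. 0)"
    using inj e c0_space_subspace(1) by (auto dest: inj_onD)
  then show False
    by (metis e_def zero_neq_one)
qed

lemma bounded_linear_operator_comp: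
  assumes S: "bounded_linear_operator X N Y M S" and T: "bounded_linear_operator Y M W L T"
    and M: "\<And>f. f \<in> Y \<Longrightarrow> M f \<ge> 0"
  shows "bounded_linear_operator X N W L (T \<circ> S)"
proof -
  obtain C D where C: "\<And>f. f \<in> X \<Longrightarrow> M (S f) \<le> C * N f"
    and D: "\<And>f. f \<in> Y \<Longrightarrow> L (T f) \<le> D * M f"
    using S T unfolding bounded_linear_operator_def by metis
  \<comment> \<open>\<open>D\<close> comes without a sign, so it is raised to \<open>max D 0\<close>
    before the bound for \<open>S\<close> is inserted.\<close>
  have "L (T (S f)) \<le> (max D 0 * C) * N f" if "f \<in> X" for f
  proof -
    have Sf: "S f \<in> Y" using S that unfolding bounded_linear_operator_def by blast
    have "L (T (S f)) \<le> D * M (S f)" by (rule D[OF Sf])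
    also have "\<dots> \<le> max D 0 * M (S f)" using M[OF Sf] by (intro mult_right_mono) auto
    also have "\<dots> \<le> max D 0 * (C * N f)" using C[OF that] by (intro mult_left_mono) auto
    finally show ?thesis by (simp add: mult.assoc)
  qed
  then show ?thesis
    unfolding bounded_linear_operator_def o_def
    by (auto simp: bounded_linear_operatorD[OF S] bounded_linear_operatorD[OF T])
qed

section \<open>The subspace\<close>

text \<open>
  The bijection \<open>g\<close> splits the coordinates into evaluations at the basis vectors and, for each
  block \<open>n\<close>, the functionals \<open>x \<mapsto> (\<Sum>\<alpha> | sel \<alpha> k. x (\<alpha>, n)) / (n + 1)\<close>; they sit at \<open>pt (\<alpha>, n)\<close> and
  at \<open>qt n k\<close> below.
\<close>

locale weighted_l1_sum =
  fixes g :: "'a \<Rightarrow> ('a \<times> nat) + (nat \<times> nat)" and sel :: "'a \<Rightarrow> nat \<Rightarrow> bool"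
  assumes bij_g: "bij g"
    and independent: "\<And>F Q. finite F \<Longrightarrow> Q \<subseteq> F \<Longrightarrow> \<exists>k. \<forall>x\<in>F. sel x k \<longleftrightarrow> x \<in> Q"
begin

text \<open>The unit vector \<open>b\<close> written as the family of its values under the norming
  functionals, so that the sup norm on combinations becomes equivalent to the weighted norm. The
  sort \<open>euclidean_space\<close> supplies the dimension that enters the constants.\<close>

definition basis_vec :: "'a \<times> nat \<Rightarrow> 'a \<Rightarrow> 'k::{real_normed_field,euclidean_space}" where
  "basis_vec b i = (case g i of Inl c \<Rightarrow> if c = b then 1 else 0
     | Inr (n, k) \<Rightarrow> if n = snd b \<and> sel (fst b) k then of_real (1 / real (Suc n)) else 0)"

definition pt :: "'a \<times> nat \<Rightarrow> 'a" where
  "pt b = inv g (Inl b)"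

definition qt :: "nat \<Rightarrow> nat \<Rightarrow> 'a" where
  "qt n k = inv g (Inr (n, k))"

lemma g_pt [simp]: "g (pt b) = Inl b" and g_qt [simp]: "g (qt n k) = Inr (n, k)"
  using bij_g by (simp_all add: pt_def qt_def bij_is_surj surj_f_inv_f)

lemma index_cases:
  obtains (pt) c where "i = pt c" | (qt) n k where "i = qt n k"
proof (cases "g i")
  case (Inl c)
  then have "i = pt c" using bij_g by (simp add: pt_def bij_is_inj inv_f_eq)
  then show ?thesis by (rule that(1))
next
  case (Inr p)
  then have "i = qt (fst p) (snd p)" using bij_g by (simp add: qt_def bij_is_inj inv_f_eq)
  then show ?thesis by (rule that(2))
qed

lemma basis_vec_pt: "basis_vec b (pt c) = (if c = b then 1 else 0)"
  and basis_vec_qt: "basis_vec b (qt n k) =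
    (if n = snd b \<and> sel (fst b) k then of_real (1 / real (Suc n)) else 0)"
  by (simp_all add: basis_vec_def)

lemma norm_basis_vec_le: "norm (basis_vec b i) \<le> 1"
  by (cases i rule: index_cases) (auto simp: basis_vec_pt basis_vec_qt norm_divide simp del: of_nat_Suc)

lemma bounded_basis_vec: "bounded (range (basis_vec b))"
  by (rule bounded_rangeI[where B = 1]) (rule norm_basis_vec_le)

text \<open>Apart from \<open>pt b\<close>, only the countably many indices \<open>qt n k\<close>
  can carry a nonzero value; this is what places the basis in \<open>linf_c_space\<close>.\<close>

lemma countable_support_basis_vec: "countable {i. basis_vec b i \<noteq> 0}"
proof -
  have "{i. basis_vec b i \<noteq> 0} \<subseteq> insert (pt b) (range (case_prod qt))"
  proof
    fix i assume "i \<in> {i. basis_vec b i \<noteq> 0}"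
    then show "i \<in> insert (pt b) (range (case_prod qt))"
      by (cases i rule: index_cases) (auto simp: basis_vec_pt split: if_splits)
  qed
  then show ?thesis
    by (rule countable_subset) auto
qed

section \<open>Finite combinations: the sup norm against the weighted l1 norm\<close>

definition comb :: "('a \<times> nat \<Rightarrow> 'k) \<Rightarrow> ('a \<times> nat) set \<Rightarrow> 'a \<Rightarrow> 'k::{real_normed_field,euclidean_space}" where
  "comb a F i = (\<Sum>b\<in>F. a b * basis_vec b i)"

lemma comb_pt: "finite F \<Longrightarrow> comb a F (pt c) = (if c \<in> F then a c else 0)"
  by (simp add: comb_def basis_vec_pt if_distrib cong: if_cong)

lemma comb_qt:
  assumes "finite F"
  shows "comb a F (qt n k) =
    of_real (1 / real (Suc n)) * (\<Sum>b | b \<in> F \<and> snd b = n \<and> sel (fst b) k. a b)"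
proof -
  have "comb a F (qt n k) =
      (\<Sum>b\<in>F. if snd b = n \<and> sel (fst b) k then of_real (1 / real (Suc n)) * a b else 0)"
    unfolding comb_def by (intro sum.cong) (auto simp: basis_vec_qt)
  also have "\<dots> = (\<Sum>b | b \<in> F \<and> snd b = n \<and> sel (fst b) k. of_real (1 / real (Suc n)) * a b)"
    by (rule sum.inter_filter[OF assms, symmetric])
  finally show ?thesis
    by (simp only: sum_distrib_left)
qed

lemma comb_diff: "comb (\<lambda>b. a b - a' b) F i = comb a F i - comb a' F i"
  by (simp add: comb_def left_diff_distrib sum_subtractf)

text \<open>By independence some \<open>k\<close> selects exactly the points of \<open>Q\<close>
  among those of \<open>G\<close>, so the sum over \<open>Q\<close> is \<open>n + 1\<close> times
  the single coordinate \<open>qt n k\<close>.\<close>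

lemma norm_subset_sum_le:
  assumes G: "finite G" "\<And>n k. norm (comb a G (qt n k)) \<le> B"
    and Q: "Q \<subseteq> {b \<in> G. snd b = n}"
  shows "norm (\<Sum>b\<in>Q. a b) \<le> real (Suc n) * B"
proof -
  obtain k where k: "\<And>x. x \<in> fst ` G \<Longrightarrow> sel x k \<longleftrightarrow> x \<in> fst ` Q"
    using independent[of "fst ` G" "fst ` Q"] G(1) Q by blast
  \<comment> \<open>Inside block \<open>n\<close> the second component is fixed, so selecting by
    first components recovers \<open>Q\<close> itself.\<close>
  have "{b. b \<in> G \<and> snd b = n \<and> sel (fst b) k} = Q"
    using k Q by (force simp: prod_eq_iff)
  then have "comb a G (qt n k) = of_real (1 / real (Suc n)) * (\<Sum>b\<in>Q. a b)"
    by (simp only: comb_qt[OF G(1)])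
  then have "norm (comb a G (qt n k)) = norm (\<Sum>b\<in>Q. a b) / real (Suc n)"
    by (simp only: norm_mult norm_of_real) simp
  then have "norm (\<Sum>b\<in>Q. a b) / real (Suc n) \<le> B"
    using G(2)[of n k] by simp
  then show ?thesis
    by (simp add: field_simps del: of_nat_Suc)
qed

text \<open>Splitting a block by the sign of each real coordinate turns bounds on all subset sums
  into a bound on the sum of norms; this is the source of the factor
  \<open>2 * DIM('k)\<close>.\<close>

lemma l1_sum_le:
  fixes a :: "'a \<times> nat \<Rightarrow> 'k::{real_normed_field,euclidean_space}"
  assumes "finite G" "\<And>n k. norm (comb a G (qt n k)) \<le> B"
  shows "(\<Sum>b | b \<in> G \<and> snd b = n. norm (a b)) \<le> 2 * real DIM('k) * (real (Suc n) * B)"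
  using assms by (intro sum_norm_allsubsets_bound norm_subset_sum_le) auto

text \<open>The converse estimate: \<open>pt c\<close> reads a single coefficient, and
  \<open>qt n k\<close> reads a partial sum of the \<open>n\<close>-th block divided by
  \<open>n + 1\<close>.\<close>

lemma norm_comb_le:
  fixes a :: "'a \<times> nat \<Rightarrow> 'k::{real_normed_field,euclidean_space}"
  assumes "finite F" "\<And>c. c \<in> F \<Longrightarrow> norm (a c) \<le> B"
    and "\<And>n. (\<Sum>b | b \<in> F \<and> snd b = n. norm (a b)) \<le> real (Suc n) * B" and "B \<ge> 0"
  shows "norm (comb a F i) \<le> B"
proof (cases i rule: index_cases)
  case (pt c)
  then show ?thesis using assms by (simp add: comb_pt)
next
  case (qt n k)
  have "norm (\<Sum>b | b \<in> F \<and> snd b = n \<and> sel (fst b) k. a b)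
      \<le> (\<Sum>b | b \<in> F \<and> snd b = n \<and> sel (fst b) k. norm (a b))"
    by (rule norm_sum)
  also have "\<dots> \<le> (\<Sum>b | b \<in> F \<and> snd b = n. norm (a b))"
    using assms(1) by (intro sum_mono2) auto
  also have "\<dots> \<le> real (Suc n) * B" by (rule assms(3))
  finally show ?thesis
    unfolding qt comb_qt[OF assms(1)] norm_mult norm_of_real
    by (simp add: field_simps del: of_nat_Suc)
qed

text \<open>Unconditionality: the weighted l1 norm decreases when terms are dropped, and the two
  preceding estimates compare it with the sup norm up to \<open>2 * DIM('k)\<close>.\<close>

lemma norm_comb_subset_le:
  fixes a :: "'a \<times> nat \<Rightarrow> 'k::{real_normed_field,euclidean_space}"
  assumes "finite G" "F \<subseteq> G" "\<And>i. norm (comb a G i) \<le> B"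
  shows "norm (comb a F i) \<le> 2 * real DIM('k) * B"
proof (rule norm_comb_le)
  have K: "1 \<le> 2 * real DIM('k)"
    using DIM_positive[where 'a = 'k] by linarith
  have B: "0 \<le> B"
    using assms(3) norm_ge_zero order_trans by blast
  then show "0 \<le> 2 * real DIM('k) * B" by simp
  show "finite F" using assms finite_subset by blast
  show "norm (a c) \<le> 2 * real DIM('k) * B" if "c \<in> F" for c
    using assms(3)[of "pt c"] assms(1,2) that mult_right_mono[OF K B] by (auto simp: comb_pt)
  show "(\<Sum>b | b \<in> F \<and> snd b = n. norm (a b)) \<le> real (Suc n) * (2 * real DIM('k) * B)" for n
  proof -
    have "(\<Sum>b | b \<in> F \<and> snd b = n. norm (a b)) \<le> (\<Sum>b | b \<in> G \<and> snd b = n. norm (a b))"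
      using assms by (intro sum_mono2) auto
    also have "\<dots> \<le> 2 * real DIM('k) * (real (Suc n) * B)"
      using assms by (intro l1_sum_le)
    finally show ?thesis by (simp only: mult_ac)
  qed
qed

section \<open>The space \<open>Z\<close>: coefficients, linear structure, closedness and
  basis\<close>

definition coef :: "('a \<Rightarrow> 'k) \<Rightarrow> 'a \<times> nat \<Rightarrow> 'k" where
  "coef f b = f (pt b)"

text \<open>Convergence of the expansion along the biorthogonal evaluations \<open>coef f\<close> is
  made the membership condition, in place of a closure of a span. Expansions then exist by
  definition, and closedness is what has to be proved.\<close>

definition Z :: "('a \<Rightarrow> 'k::{real_normed_field,euclidean_space}) set" where
  "Z = {f \<in> linf_c_space. represents sup_norm UNIV basis_vec (coef f) f}"

lemma mem_Z_iff:
  "f \<in> Z \<longleftrightarrow> f \<in> linf_c_space \<and> (\<forall>e>0. \<exists>F0. finite F0 \<and>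
     (\<forall>F. finite F \<and> F0 \<subseteq> F \<longrightarrow> (\<forall>i. norm (comb (coef f) F i - f i) \<le> e)))"
proof (cases "f \<in> linf_c_space")
  case True
  then have "bounded (range f)" by (simp add: linf_c_space_def)
  then show ?thesis
    using True represents_sup_norm_iff[OF _ bounded_basis_vec, of f]
    by (simp add: Z_def comb_def)
qed (simp add: Z_def)

lemma Z_bounded: "f \<in> Z \<Longrightarrow> bounded (range f)"
  by (simp add: Z_def linf_c_space_def)

lemma Z_approx:
  assumes "f \<in> Z" "e > 0" "finite F"
  obtains G where "finite G" "F \<subseteq> G" "\<And>i. norm (comb (coef f) G i - f i) \<le> e"
proof -
  obtain F0 where "finite F0"
    "\<And>F i. finite F \<Longrightarrow> F0 \<subseteq> F \<Longrightarrow> norm (comb (coef f) F i - f i) \<le> e"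
    using assms(1,2) unfolding mem_Z_iff by meson
  then show ?thesis
    using assms(3) that[of "F0 \<union> F"] by simp
qed

text \<open>The partial sum over \<open>F\<close> is a sub-sum of one over a larger \<open>G\<close>
  that is within \<open>d\<close> of \<open>f\<close>; unconditionality bounds it, and
  \<open>d\<close> is scaled so that the error contributes exactly \<open>e\<close>.\<close>

lemma norm_comb_coef_le:
  fixes f :: "'a \<Rightarrow> 'k::{real_normed_field,euclidean_space}"
  assumes f: "f \<in> Z" and B: "\<And>i. norm (f i) \<le> B" and F: "finite F"
  shows "norm (comb (coef f) F i) \<le> 2 * real DIM('k) * B"
proof (rule field_le_epsilon)
  fix e :: real assume "e > 0"
  define d where "d = e / (2 * real DIM('k))"
  have "d > 0" using \<open>e > 0\<close> by (simp add: d_def)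
  then obtain G where G: "finite G" "F \<subseteq> G" "\<And>i. norm (comb (coef f) G i - f i) \<le> d"
    using Z_approx[OF f _ F] by metis
  have "norm (comb (coef f) G i) \<le> B + d" for i
    using norm_triangle_sub[of "comb (coef f) G i" "f i"] G(3)[of i] B[of i] by linarith
  then have "norm (comb (coef f) F i) \<le> 2 * real DIM('k) * (B + d)"
    using G by (intro norm_comb_subset_le)
  also have "\<dots> = 2 * real DIM('k) * B + e"
    by (simp add: d_def distrib_left)
  finally show "norm (comb (coef f) F i) \<le> 2 * real DIM('k) * B + e" .
qed

lemma Z_zero: "(\<lambda>i. 0) \<in> Z"
  by (auto simp: mem_Z_iff linf_c_space_def coef_def comb_def image_constant_conv)

lemma Z_add:
  assumes "f \<in> Z" "h \<in> Z"
  shows "(\<lambda>i. f i + h i) \<in> Z"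
  unfolding mem_Z_iff
proof (intro conjI allI impI)
  have "bounded (range (\<lambda>i. f i + h i))"
  proof (rule bounded_rangeI)
    show "norm (f i + h i) \<le> sup_norm f + sup_norm h" for i
      using norm_triangle_ineq[of "f i" "h i"] norm_le_sup_norm[OF Z_bounded[OF assms(1)], of i]
        norm_le_sup_norm[OF Z_bounded[OF assms(2)], of i] by linarith
  qed
  moreover have "countable {i. f i + h i \<noteq> 0}"
  proof (rule countable_subset)
    show "{i. f i + h i \<noteq> 0} \<subseteq> {i. f i \<noteq> 0} \<union> {i. h i \<noteq> 0}" by auto
    show "countable ({i. f i \<noteq> 0} \<union> {i. h i \<noteq> 0})"
      using assms by (simp add: Z_def linf_c_space_def)
  qed
  ultimately show "(\<lambda>i. f i + h i) \<in> linf_c_space"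
    by (simp add: linf_c_space_def)
next
  fix e :: real assume "e > 0"
  then have "e/2 > 0" by simp
  obtain F1 where F1: "finite F1"
    "\<And>F i. finite F \<Longrightarrow> F1 \<subseteq> F \<Longrightarrow> norm (comb (coef f) F i - f i) \<le> e/2"
    using assms(1) \<open>e/2 > 0\<close> unfolding mem_Z_iff by meson
  obtain F2 where F2: "finite F2"
    "\<And>F i. finite F \<Longrightarrow> F2 \<subseteq> F \<Longrightarrow> norm (comb (coef h) F i - h i) \<le> e/2"
    using assms(2) \<open>e/2 > 0\<close> unfolding mem_Z_iff by meson
  have eq: "comb (coef (\<lambda>i. f i + h i)) F i = comb (coef f) F i + comb (coef h) F i" for F i
    by (simp add: comb_def coef_def distrib_right sum.distrib)
  have "norm (comb (coef (\<lambda>i. f i + h i)) F i - (f i + h i)) \<le> e"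
    if "finite F" "F1 \<union> F2 \<subseteq> F" for F i
    using F1(2)[of F i] F2(2)[of F i] that
      norm_triangle_ineq[of "comb (coef f) F i - f i" "comb (coef h) F i - h i"]
    by (simp add: eq algebra_simps)
  with F1(1) F2(1) show "\<exists>F0. finite F0 \<and> (\<forall>F. finite F \<and> F0 \<subseteq> F \<longrightarrow>
      (\<forall>i. norm (comb (coef (\<lambda>i. f i + h i)) F i - (f i + h i)) \<le> e))"
    by (intro exI[of _ "F1 \<union> F2"]) auto
qed

lemma Z_scale:
  assumes "f \<in> Z"
  shows "(\<lambda>i. c * f i) \<in> Z"
proof (cases "c = 0")
  case False
  show ?thesis
    unfolding mem_Z_iff
  proof (intro conjI allI impI)
    have "bounded (range (\<lambda>i. c * f i))"
      by (rule bounded_rangeI[where B = "norm c * sup_norm f"])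
        (simp add: norm_mult mult_left_mono norm_le_sup_norm[OF Z_bounded[OF assms]])
    then show "(\<lambda>i. c * f i) \<in> linf_c_space"
      using assms False by (simp add: linf_c_space_def Z_def)
  next
    fix e :: real assume "e > 0"
    then have "e / norm c > 0" using False by simp
    then obtain F0 where F0: "finite F0"
      "\<And>F i. finite F \<Longrightarrow> F0 \<subseteq> F \<Longrightarrow> norm (comb (coef f) F i - f i) \<le> e / norm c"
      using assms unfolding mem_Z_iff by meson
    have "norm (comb (coef (\<lambda>i. c * f i)) F i - c * f i) \<le> e" if "finite F" "F0 \<subseteq> F" for F i
    proof -
      have "comb (coef (\<lambda>i. c * f i)) F i - c * f i = c * (comb (coef f) F i - f i)"
        by (simp add: comb_def coef_def sum_distrib_left mult_ac right_diff_distrib)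
      then show ?thesis
        using F0(2)[OF that, of i] False by (simp only: norm_mult) (simp add: field_simps)
    qed
    with F0(1) show "\<exists>F0. finite F0 \<and> (\<forall>F. finite F \<and> F0 \<subseteq> F \<longrightarrow>
        (\<forall>i. norm (comb (coef (\<lambda>i. c * f i)) F i - c * f i) \<le> e))" by blast
  qed
qed (simp add: Z_zero)

lemma Z_diff:
  assumes "f \<in> Z" "h \<in> Z"
  shows "(\<lambda>i. f i - h i) \<in> Z"
  using Z_add[OF assms(1) Z_scale[OF assms(2), of "-1"]] by simp

lemma basis_vec_in_Z: "(basis_vec b :: 'a \<Rightarrow> 'k::{real_normed_field,euclidean_space}) \<in> Z"
  unfolding mem_Z_iff
proof (intro conjI allI impI)
  show "(basis_vec b :: 'a \<Rightarrow> 'k) \<in> linf_c_space"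
    by (simp add: linf_c_space_def countable_support_basis_vec bounded_basis_vec)
  fix e :: real assume "e > 0"
  have "comb (coef (basis_vec b)) F i = (basis_vec b i :: 'k)" if "finite F" "{b} \<subseteq> F" for F i
  proof -
    have "comb (coef (basis_vec b)) F i = (\<Sum>c\<in>F. if c = b then basis_vec b i else 0 :: 'k)"
      unfolding comb_def by (intro sum.cong) (auto simp: coef_def basis_vec_pt)
    then show ?thesis using that by simp
  qed
  with \<open>e > 0\<close> show "\<exists>F0. finite F0 \<and> (\<forall>F. finite F \<and> F0 \<subseteq> F \<longrightarrow>
      (\<forall>i. norm (comb (coef (basis_vec b)) F i - (basis_vec b i :: 'k)) \<le> e))"
    by (intro exI[of _ "{b}"]) auto
qed

text \<open>
  The partial sum operators are uniformly bounded on \<open>Z\<close>; letting the second index of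
  \<open>s m - s n\<close> tend to infinity extends the bound to \<open>s m - f\<close>.
\<close>

lemma Z_closed:
  fixes f :: "'a \<Rightarrow> 'k::{real_normed_field,euclidean_space}"
  assumes s: "\<And>n. s n \<in> Z" and f: "f \<in> linf_c_space"
    and lim: "(\<lambda>n. sup_norm (\<lambda>i. s n i - f i)) \<longlonglongrightarrow> 0"
  shows "f \<in> Z"
  unfolding mem_Z_iff
proof (intro conjI allI impI f)
  fix e :: real assume "e > 0"
  define K where "K = 2 * real DIM('k)"
  \<comment> \<open>The final estimate adds \<open>d\<close>, \<open>d\<close> and
    \<open>K * (2 * d)\<close>, which is \<open>e\<close> in total.\<close>
  define d where "d = e / (2 * K + 2)"
  have "K > 0" by (simp add: K_def)
  then have "d > 0" using \<open>e > 0\<close> by (simp add: d_def)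
  have "bounded (range f)" using f by (simp add: linf_c_space_def)
  then have "bounded (range (\<lambda>i. s n i - f i))" for n
    by (intro bounded_diff_functions Z_bounded[OF s])
  note le = norm_le_sup_norm[OF this]
  have "eventually (\<lambda>n. sup_norm (\<lambda>i. s n i - f i) < d) sequentially"
    using lim \<open>d > 0\<close> by (rule order_tendstoD)
  then obtain m where m: "\<And>n. n \<ge> m \<Longrightarrow> sup_norm (\<lambda>i. s n i - f i) < d"
    by (auto simp: eventually_sequentially)
  have sd: "norm (s n i - f i) \<le> d" if "n \<ge> m" for n i
    using le[of n i] m[OF that] by linarith
  have ptw: "(\<lambda>n. s n i) \<longlonglongrightarrow> f i" for i
  proof -
    have "(\<lambda>n. s n i - f i) \<longlonglongrightarrow> 0"
      using lim by (rule Lim_null_comparison[rotated]) (simp add: le)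
    then show ?thesis by (simp add: LIM_zero_iff)
  qed
  have step: "norm (comb (coef (s m)) F i - comb (coef f) F i) \<le> K * (2 * d)" if "finite F" for F i
  proof (rule tendsto_upperbound)
    show "(\<lambda>n. norm (comb (coef (s m)) F i - comb (coef (s n)) F i))
        \<longlonglongrightarrow> norm (comb (coef (s m)) F i - comb (coef f) F i)"
      unfolding comb_def coef_def by (intro tendsto_intros ptw)
    have "norm (comb (coef (s m)) F i - comb (coef (s n)) F i) \<le> K * (2 * d)" if "n \<ge> m" for n
    proof -
      have "norm (s m i - s n i) \<le> 2 * d" for i
        using sd[of m i] sd[OF that, of i] norm_triangle_ineq4[of "s m i - f i" "s n i - f i"] by simp
      then have "norm (comb (coef (\<lambda>i. s m i - s n i)) F i) \<le> K * (2 * d)"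
        unfolding K_def by (intro norm_comb_coef_le Z_diff s \<open>finite F\<close>)
      moreover have "coef (\<lambda>i. s m i - s n i) = (\<lambda>b. coef (s m) b - coef (s n) b)"
        by (simp add: coef_def fun_eq_iff)
      ultimately show ?thesis by (simp add: comb_diff)
    qed
    then show "\<forall>\<^sub>F n in sequentially.
        norm (comb (coef (s m)) F i - comb (coef (s n)) F i) \<le> K * (2 * d)"
      by (auto simp: eventually_sequentially)
  qed simp
  obtain F0 where F0: "finite F0"
    "\<And>F i. finite F \<Longrightarrow> F0 \<subseteq> F \<Longrightarrow> norm (comb (coef (s m)) F i - s m i) \<le> d"
    using s[of m] \<open>d > 0\<close> unfolding mem_Z_iff by meson
  have "norm (comb (coef f) F i - f i) \<le> e" if "finite F" "F0 \<subseteq> F" for F i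
  proof -
    let ?x = "comb (coef (s m)) F i - s m i" and ?y = "s m i - f i"
      and ?w = "comb (coef (s m)) F i - comb (coef f) F i"
    have "norm (comb (coef f) F i - f i) = norm (?x + ?y - ?w)" by simp
    also have "\<dots> \<le> norm ?x + norm ?y + norm ?w"
      using norm_triangle_ineq4[of "?x + ?y" ?w] norm_triangle_ineq[of ?x ?y] by linarith
    also have "\<dots> \<le> d + d + K * (2 * d)"
      using F0(2)[OF that, of i] sd[of m i] step[OF that(1), of i] by linarith
    also have "\<dots> = (2 * K + 2) * d" by (simp add: algebra_simps)
    also have "\<dots> = e" using \<open>K > 0\<close> by (simp add: d_def)
    finally show ?thesis .
  qed
  with F0(1) show "\<exists>F0. finite F0 \<and> (\<forall>F. finite F \<and> F0 \<subseteq> F \<longrightarrow>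
      (\<forall>i. norm (comb (coef f) F i - f i) \<le> e))" by blast
qed

lemma closed_subspace_Z: "closed_subspace_of Z linf_c_space sup_norm"
  unfolding closed_subspace_of_def
proof (intro conjI)
  show "Z \<subseteq> linf_c_space" by (auto simp: Z_def)
qed (use Z_zero Z_add Z_scale Z_closed in blast)+

text \<open>Existence of expansions is built into \<open>Z\<close>. For uniqueness, evaluate at
  \<open>pt b\<close>: every partial sum containing \<open>b\<close> has the value
  \<open>a b\<close> there, and these values converge to \<open>coef f b\<close>.\<close>

lemma unconditional_basis_Z:
  "has_unconditional_basis (Z :: ('a \<Rightarrow> 'k::{real_normed_field,euclidean_space}) set) sup_norm"
proof (rule has_unconditional_basisI)
  show "inj (basis_vec :: 'a \<times> nat \<Rightarrow> 'a \<Rightarrow> 'k)"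
  proof (rule injI)
    fix b c assume "basis_vec b = (basis_vec c :: 'a \<Rightarrow> 'k)"
    then have "basis_vec b (pt b) = (basis_vec c (pt b) :: 'k)" by simp
    then show "b = c" by (simp add: basis_vec_pt split: if_splits)
  qed
  show "unconditional_basis (Z :: ('a \<Rightarrow> 'k) set) sup_norm UNIV basis_vec"
    unfolding unconditional_basis_def
  proof (intro conjI ballI)
    fix f :: "'a \<Rightarrow> 'k" assume f: "f \<in> Z"
    have "a b = coef f b" if a: "represents sup_norm UNIV basis_vec a f" for a b
    proof -
      have "norm (a b - coef f b) \<le> 0 + e" if "e > 0" for e
      proof -
        obtain F0 where F0: "finite F0"
          "\<And>F i. finite F \<Longrightarrow> F0 \<subseteq> F \<Longrightarrow> norm (comb a F i - f i) \<le> e"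
          using a \<open>e > 0\<close> unfolding represents_sup_norm_iff[OF Z_bounded[OF f] bounded_basis_vec]
            comb_def by meson
        show ?thesis
          using F0(2)[of "insert b F0" "pt b"] F0(1) by (auto simp: comb_pt coef_def)
      qed
      then have "norm (a b - coef f b) \<le> 0" by (rule field_le_epsilon)
      then show ?thesis by simp
    qed
    then show "\<exists>a. represents sup_norm UNIV basis_vec a f \<and>
        (\<forall>a'. represents sup_norm UNIV basis_vec a' f \<longrightarrow> (\<forall>b\<in>UNIV. a' b = a b))"
      using f by (intro exI[of _ "coef f"]) (auto simp: Z_def)
  qed (rule basis_vec_in_Z)
qed

text \<open>
  On the \<open>n\<close>-th block, sums of \<open>n + 1\<close> unimodular multiples of basis vectors have norm one, so
  each functional is at most \<open>C / (n + 1)\<close> on all but finitely many basis vectors of that block.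
\<close>

lemma not_embeds_Z_linf:
  assumes unc: "uncountable (UNIV :: 'a set)"
  shows "\<not> embeds (Z :: ('a \<Rightarrow> 'k::{real_normed_field,euclidean_space}) set) sup_norm
    (linf_space :: (nat \<Rightarrow> 'k) set) sup_norm"
proof
  assume "embeds (Z :: ('a \<Rightarrow> 'k) set) sup_norm (linf_space :: (nat \<Rightarrow> 'k) set) sup_norm"
  then obtain T :: "('a \<Rightarrow> 'k) \<Rightarrow> nat \<Rightarrow> 'k" and c
    where T: "bounded_linear_operator Z sup_norm linf_space sup_norm T"
      and c: "c > 0" "\<And>f. f \<in> Z \<Longrightarrow> c * sup_norm f \<le> sup_norm (T f)"
    unfolding embeds_def by blast
  obtain C0 where C0: "\<And>f. f \<in> Z \<Longrightarrow> sup_norm (T f) \<le> C0 * sup_norm f"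
    using bounded_linear_operatorD(4)[OF T] by blast
  define C where "C = max C0 0"
  \<comment> \<open>The block is chosen so late that the upper bound \<open>C / (n + 1)\<close>
    drops below the lower bound \<open>c\<close> of the embedding.\<close>
  obtain n :: nat where "C / c < real n"
    using reals_Archimedean2 by blast
  then have n: "C / real (Suc n) < c"
    using c(1) by (simp add: field_simps)
  define t where "t k x = T (basis_vec (x, n)) k" for k x
  have "finite {x. norm (t k x) > C / real (Suc n)}" for k
  proof (rule finite_large_values)
    fix F :: "'a set" and u :: "'a \<Rightarrow> 'k"
    assume F: "finite F" "card F = Suc n" and u: "\<And>x. norm (u x) \<le> 1"
    define f where "f i = (\<Sum>x\<in>F. u x * basis_vec (x, n) i)" for i
    have f: "f \<in> Z" "T f = (\<lambda>k. \<Sum>x\<in>F. u x * t k x)"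
      unfolding f_def t_def
      using bounded_linear_operator_sum[OF T Z_zero Z_add Z_scale,
          where F = F and a = u and z = "\<lambda>x. basis_vec (x, n)"] basis_vec_in_Z by blast+
    \<comment> \<open>All terms lie in block \<open>n\<close>, so the l1 sum there is at most
      \<open>n + 1\<close> and the weight brings it down to 1.\<close>
    have f_comb: "f = comb (\<lambda>b. u (fst b)) ((\<lambda>x. (x, n)) ` F)"
      by (auto simp: f_def comb_def sum.reindex inj_on_def)
    have fi: "norm (f i) \<le> 1" for i
      unfolding f_comb
    proof (rule norm_comb_le)
      fix m
      have "(\<Sum>b | b \<in> (\<lambda>x. (x, n)) ` F \<and> snd b = m. norm (u (fst b)))
          \<le> (\<Sum>b | b \<in> (\<lambda>x. (x, n)) ` F \<and> snd b = m. 1)"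
        by (intro sum_mono u)
      also have "\<dots> \<le> real (Suc m)"
      proof (cases "m = n")
        case True
        then have "{b. b \<in> (\<lambda>x. (x, n)) ` F \<and> snd b = m} = (\<lambda>x. (x, n)) ` F" by auto
        then show ?thesis
          using True F by (simp add: card_image inj_on_def)
      next
        case False
        then have "{b. b \<in> (\<lambda>x. (x, n)) ` F \<and> snd b = m} = {}" by auto
        then show ?thesis by (simp only: sum.empty)
      qed
      finally show "(\<Sum>b | b \<in> (\<lambda>x. (x, n)) ` F \<and> snd b = m. norm (u (fst b))) \<le> real (Suc m) * 1"
        by simp
    qed (use F u in auto)
    have "bounded (range (T f))"
      using bounded_linear_operatorD(1)[OF T f(1)] by (simp add: linf_space_def)
    then have "norm (T f k) \<le> sup_norm (T f)"
      by (rule norm_le_sup_norm)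
    also have "\<dots> \<le> C0 * sup_norm f" by (rule C0[OF f(1)])
    also have "\<dots> \<le> C * 1"
      using sup_norm_le[of f 1] fi sup_norm_nonneg[OF Z_bounded[OF f(1)]]
      by (intro mult_mono) (auto simp: C_def)
    finally show "norm (\<Sum>x\<in>F. u x * t k x) \<le> C" by (simp add: f(2))
  qed simp
  then have "countable (\<Union>k. {x. norm (t k x) > C / real (Suc n)})"
    by (intro countable_UN countableI_type countable_finite)
  \<comment> \<open>The exceptional sets of all coordinates together are countable, while the block
    is uncountable.\<close>
  then obtain x where x: "\<And>k. norm (t k x) \<le> C / real (Suc n)"
    using unc by (metis (mono_tags, lifting) UNIV_I UNIV_eq_I UN_I mem_Collect_eq not_le)
  have "1 \<le> sup_norm (basis_vec (x, n) :: 'a \<Rightarrow> 'k)"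
    using norm_le_sup_norm[OF bounded_basis_vec, of "(x, n)" "pt (x, n)"] by (simp add: basis_vec_pt)
  then have "c \<le> c * sup_norm (basis_vec (x, n) :: 'a \<Rightarrow> 'k)"
    using c(1) by simp
  also have "\<dots> \<le> sup_norm (T (basis_vec (x, n)))"
    by (rule c(2)[OF basis_vec_in_Z])
  also have "\<dots> \<le> C / real (Suc n)"
    using x unfolding t_def by (rule sup_norm_le)
  finally show False using n by simp
qed

section \<open>The injection into bounded sequences by the block functionals
  \<open>qt n k\<close>\<close>

definition restr :: "('a \<Rightarrow> 'k) \<Rightarrow> nat \<Rightarrow> 'k" where
  "restr f m = f (case_prod qt (prod_decode m))"

lemma bounded_linear_operator_restr:
  "bounded_linear_operator Z sup_norm linf_space sup_norm restr"
  unfolding bounded_linear_operator_def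
proof (intro conjI ballI allI exI)
  fix f :: "'a \<Rightarrow> 'k::{real_normed_field,euclidean_space}" assume "f \<in> Z"
  then have le: "norm (restr f m) \<le> sup_norm f" for m
    unfolding restr_def by (intro norm_le_sup_norm Z_bounded)
  then show "restr f \<in> linf_space"
    unfolding linf_space_def by (blast intro: bounded_rangeI)
  show "sup_norm (restr f) \<le> 1 * sup_norm f"
    using le by (simp add: sup_norm_le)
qed (auto simp: restr_def)

text \<open>If all block coordinates of \<open>d\<close> vanish, those of its partial sums are
  small. The subset estimate for the singleton of \<open>b\<close> then forces each coefficient to
  be 0, and \<open>d\<close> is the limit of its partial sums.\<close>

lemma inj_on_restr: "inj_on restr Z"
proof (rule inj_onI)
  fix f h :: "'a \<Rightarrow> 'k::{real_normed_field,euclidean_space}"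
  assume fh: "f \<in> Z" "h \<in> Z" and eq: "restr f = restr h"
  define d where "d i = f i - h i" for i
  have d: "d \<in> Z" unfolding d_def by (intro Z_diff fh)
  have dq: "d (qt n k) = 0" for n k
    using fun_cong[OF eq, of "prod_encode (n, k)"] by (simp add: restr_def d_def)
  have "coef d b = 0" for b
  proof -
    have "norm (coef d b) \<le> 0 + e" if "e > 0" for e
    proof -
      \<comment> \<open>The division cancels the factor \<open>n + 1\<close> of the subset estimate
        in the block of \<open>b\<close>.\<close>
      define e' where "e' = e / real (Suc (snd b))"
      have "e' > 0" using \<open>e > 0\<close> by (simp add: e'_def)
      then obtain G where G: "finite G" "{b} \<subseteq> G" "\<And>i. norm (comb (coef d) G i - d i) \<le> e'"
        using Z_approx[OF d, of e' "{b}"] by auto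
      have "norm (comb (coef d) G (qt n k)) \<le> e'" for n k
        using G(3)[of "qt n k"] by (simp add: dq)
      then have "norm (\<Sum>b\<in>{b}. coef d b) \<le> real (Suc (snd b)) * e'"
        using G by (intro norm_subset_sum_le) auto
      then show ?thesis by (simp add: e'_def)
    qed
    then have "norm (coef d b) \<le> 0" by (rule field_le_epsilon)
    then show ?thesis by simp
  qed
  then have comb0: "comb (coef d) G i = 0" for G i
    by (simp add: comb_def)
  have "d i = 0" for i
  proof -
    have "norm (d i) \<le> 0 + e" if "e > 0" for e
      using Z_approx[OF d that finite.emptyI] comb0 by (metis add_0 diff_0 norm_minus_cancel)
    then have "norm (d i) \<le> 0" by (rule field_le_epsilon)
    then show ?thesis by simp
  qed
  then show "f = h" by (auto simp: d_def)
qed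

text \<open>An embedding is injective, so composing it with \<open>restr\<close> would inject
  \<open>c0_space\<close> into the bounded sequences.\<close>

lemma not_embeds_c0_Z:
  assumes "uncountable (UNIV :: 'i set)"
  shows "\<not> embeds (c0_space :: ('i \<Rightarrow> 'k::{real_normed_field,euclidean_space}) set) sup_norm
    (Z :: ('a \<Rightarrow> 'k) set) sup_norm"
proof
  assume "embeds (c0_space :: ('i \<Rightarrow> 'k) set) sup_norm (Z :: ('a \<Rightarrow> 'k) set) sup_norm"
  then obtain S :: "('i \<Rightarrow> 'k) \<Rightarrow> 'a \<Rightarrow> 'k" and c
    where S: "bounded_linear_operator c0_space sup_norm Z sup_norm S"
      and c: "c > 0" "\<And>f. f \<in> c0_space \<Longrightarrow> c * sup_norm f \<le> sup_norm (S f)"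
    unfolding embeds_def by blast
  have "inj_on S c0_space"
  proof (rule inj_onI)
    fix f h :: "'i \<Rightarrow> 'k" assume fh: "f \<in> c0_space" "h \<in> c0_space" "S f = S h"
    let ?h = "\<lambda>i. - 1 * h i"
    let ?d = "\<lambda>i. f i + ?h i"
    have h': "?h \<in> c0_space" using fh(2) by (rule c0_space_subspace(3))
    have d: "?d \<in> c0_space" by (rule c0_space_subspace(2)[OF fh(1) h'])
    have "S ?d = (\<lambda>i. S f i + S ?h i)"
      by (rule bounded_linear_operatorD(2)[OF S fh(1) h'])
    also have "S ?h = (\<lambda>i. - 1 * S h i)"
      by (rule bounded_linear_operatorD(3)[OF S fh(2)])
    finally have "S ?d = (\<lambda>i. 0)" using fh(3) by simp
    then have "sup_norm (S ?d) \<le> 0" by (intro sup_norm_le) simp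
    then have "sup_norm ?d \<le> 0"
      using c(1) c(2)[OF d] by (metis mult_le_0_iff not_le order_trans)
    moreover have "bounded (range ?d)"
      by (rule c0_space_bounded[OF d])
    ultimately have "norm (?d i) \<le> 0" for i
      using norm_le_sup_norm[of ?d i] by linarith
    then show "f = h" by (auto simp: fun_eq_iff)
  qed
  moreover have "inj_on restr (S ` c0_space)"
    by (rule inj_on_subset[OF inj_on_restr]) (use bounded_linear_operatorD(1)[OF S] in blast)
  ultimately have "inj_on (restr \<circ> S) c0_space"
    by (rule comp_inj_on)
  moreover have "bounded_linear_operator c0_space sup_norm linf_space sup_norm (restr \<circ> S)"
    using S bounded_linear_operator_restr sup_norm_nonneg[OF Z_bounded]
    by (rule bounded_linear_operator_comp)
  ultimately show False
    using no_injective_operator_c0_linf[OF assms] by blast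
qed

text \<open>Block 0 has weight 1, so \<open>x\<close> is mapped to the sum of the
  \<open>x \<alpha>\<close> multiples of its basis vectors. The sum is taken pointwise; that it lies
  in \<open>Z\<close> follows from l1 tails.\<close>

lemma embeds_l1_Z:
  "embeds (l1_space :: ('a \<Rightarrow> 'k::{real_normed_field,euclidean_space}) set) l1_norm Z sup_norm"
proof -
  define U where "U x i = (\<Sum>\<^sub>\<infinity>\<alpha>. x \<alpha> * basis_vec (\<alpha>, 0) i)" for x :: "'a \<Rightarrow> 'k" and i
  have term_le: "norm (x \<alpha> * basis_vec (\<alpha>, 0) i) \<le> norm (x \<alpha>)" for x :: "'a \<Rightarrow> 'k" and \<alpha> i
    using mult_left_mono[OF norm_basis_vec_le, of "norm (x \<alpha>)"] by (simp add: norm_mult)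
  have abs: "(\<lambda>\<alpha>. norm (x \<alpha> * basis_vec (\<alpha>, 0) i)) summable_on A"
    if "x \<in> l1_space" for x :: "'a \<Rightarrow> 'k" and i A
  proof (rule Infinite_Sum.abs_summable_on_comparison_test)
    show "(\<lambda>\<alpha>. norm (x \<alpha>)) summable_on A"
      using that summable_on_subset_banach unfolding l1_space_def by blast
  qed (rule term_le)
  note summ = abs_summable_summable[OF abs]
  have xsum: "(\<lambda>\<alpha>. norm (x \<alpha>)) summable_on A" if "x \<in> l1_space" for x :: "'a \<Rightarrow> 'k" and A
    using that summable_on_subset_banach unfolding l1_space_def by blast
  have le: "norm (\<Sum>\<^sub>\<infinity>\<alpha>\<in>A. x \<alpha> * basis_vec (\<alpha>, 0) i) \<le> (\<Sum>\<^sub>\<infinity>\<alpha>\<in>A. norm (x \<alpha>))"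
    if "x \<in> l1_space" for x :: "'a \<Rightarrow> 'k" and i A
  proof -
    have "norm (\<Sum>\<^sub>\<infinity>\<alpha>\<in>A. x \<alpha> * basis_vec (\<alpha>, 0) i) \<le> (\<Sum>\<^sub>\<infinity>\<alpha>\<in>A. norm (x \<alpha> * basis_vec (\<alpha>, 0) i))"
      by (rule norm_infsum_bound[OF abs[OF that]])
    also have "\<dots> \<le> (\<Sum>\<^sub>\<infinity>\<alpha>\<in>A. norm (x \<alpha>))"
      using that by (intro infsum_mono abs xsum term_le)
    finally show ?thesis .
  qed
  have U_le: "norm (U x i) \<le> l1_norm x" if "x \<in> l1_space" for x i
    unfolding U_def l1_norm_def by (rule le[OF that])
  have coef_U: "coef (U x) (\<beta>, n) = (if n = 0 then x \<beta> else 0)" for x \<beta> n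
  proof -
    have "U x (pt (\<beta>, n)) = (\<Sum>\<^sub>\<infinity>\<alpha>\<in>{\<beta>}. if n = 0 then x \<alpha> else 0)"
      unfolding U_def by (rule infsum_cong_neutral) (auto simp: basis_vec_pt)
    then show ?thesis by (simp add: coef_def)
  qed
  have U_Z: "U x \<in> Z" if x: "x \<in> l1_space" for x
    unfolding mem_Z_iff
  proof (intro conjI allI impI)
    have "{i. U x i \<noteq> 0} \<subseteq> (\<Union>\<alpha>\<in>{\<alpha>. x \<alpha> \<noteq> 0}. {i. basis_vec (\<alpha>, 0) i \<noteq> (0 :: 'k)})"
    proof
      fix i assume i: "i \<in> {i. U x i \<noteq> 0}"
      show "i \<in> (\<Union>\<alpha>\<in>{\<alpha>. x \<alpha> \<noteq> 0}. {i. basis_vec (\<alpha>, 0) i \<noteq> (0 :: 'k)})"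
      proof (rule ccontr)
        assume "\<not> ?thesis"
        then have "x \<alpha> * basis_vec (\<alpha>, 0) i = 0" for \<alpha> by auto
        then have "U x i = 0" unfolding U_def by (intro infsum_0)
        then show False using i by simp
      qed
    qed
    moreover have "countable {\<alpha>. x \<alpha> \<noteq> 0}"
      using abs_summable_countable[of x UNIV] x by (simp add: l1_space_def)
    ultimately have "countable {i. U x i \<noteq> 0}"
      by (rule countable_subset[OF _ countable_UN]) (rule countable_support_basis_vec)
    then show "U x \<in> linf_c_space"
      using U_le[OF x] by (auto simp: linf_c_space_def intro: bounded_rangeI)
  next
    fix e :: real assume "e > 0"
    \<comment> \<open>Entries of basis vectors have norm at most 1, so this tail bounds the
      remainder at every coordinate.\<close>
    obtain A0 where A0: "finite A0" "(\<Sum>\<^sub>\<infinity>\<alpha>\<in>UNIV - A0. norm (x \<alpha>)) \<le> e"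
    proof -
      obtain A0 where A0: "finite A0"
        "dist (\<Sum>\<alpha>\<in>A0. norm (x \<alpha>)) (\<Sum>\<^sub>\<infinity>\<alpha>. norm (x \<alpha>)) \<le> e"
        using infsum_finite_approximation[OF xsum[OF x, of UNIV] \<open>e > 0\<close>] by blast
      have "(\<Sum>\<^sub>\<infinity>\<alpha>\<in>UNIV - A0. norm (x \<alpha>)) = (\<Sum>\<^sub>\<infinity>\<alpha>. norm (x \<alpha>)) - (\<Sum>\<alpha>\<in>A0. norm (x \<alpha>))"
        using A0(1) by (subst infsum_Diff) (auto intro: xsum[OF x])
      then show ?thesis
        using that[OF A0(1)] A0(2) by (simp add: dist_real_def)
    qed
    have "norm (comb (coef (U x)) F i - U x i) \<le> e"
      if F: "finite F" "(\<lambda>\<alpha>. (\<alpha>, 0)) ` A0 \<subseteq> F" for F i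
    proof -
      define A where "A = {\<alpha>. (\<alpha>, 0) \<in> F}"
      have "A \<subseteq> fst ` F" by (force simp: A_def)
      then have A: "finite A" "A0 \<subseteq> A"
        using F by (blast intro: finite_subset, auto simp: A_def)
      \<comment> \<open>The coefficients of \<open>U x\<close> vanish outside block 0, so only
        \<open>A\<close> contributes.\<close>
      have "comb (coef (U x)) F i = (\<Sum>b\<in>(\<lambda>\<alpha>. (\<alpha>, 0)) ` A. coef (U x) b * basis_vec b i)"
        unfolding comb_def using F(1)
        by (intro sum.mono_neutral_right) (auto simp: A_def coef_U image_iff)
      also have "\<dots> = (\<Sum>\<alpha>\<in>A. x \<alpha> * basis_vec (\<alpha>, 0) i)"
        by (simp add: sum.reindex inj_on_def coef_U)
      also have "\<dots> - U x i = - (\<Sum>\<^sub>\<infinity>\<alpha>\<in>UNIV - A. x \<alpha> * basis_vec (\<alpha>, 0) i)"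
        unfolding U_def using A(1) by (subst infsum_Diff) (auto intro: summ[OF x])
      finally have "norm (comb (coef (U x)) F i - U x i) =
          norm (\<Sum>\<^sub>\<infinity>\<alpha>\<in>UNIV - A. x \<alpha> * basis_vec (\<alpha>, 0) i)"
        by simp
      also have "\<dots> \<le> (\<Sum>\<^sub>\<infinity>\<alpha>\<in>UNIV - A. norm (x \<alpha>))" by (rule le[OF x])
      also have "\<dots> \<le> (\<Sum>\<^sub>\<infinity>\<alpha>\<in>UNIV - A0. norm (x \<alpha>))"
        using A(2) by (intro infsum_mono_neutral xsum[OF x]) auto
      also have "\<dots> \<le> e" by (rule A0(2))
      finally show ?thesis .
    qed
    with A0(1) show "\<exists>F0. finite F0 \<and> (\<forall>F. finite F \<and> F0 \<subseteq> F \<longrightarrow>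
        (\<forall>i. norm (comb (coef (U x)) F i - U x i) \<le> e))"
      by (intro exI[of _ "(\<lambda>\<alpha>. (\<alpha>, 0)) ` A0"]) auto
  qed
  define K where "K = 2 * real DIM('k)"
  have "K > 0" by (simp add: K_def)
  have lower: "l1_norm x \<le> K * (K * sup_norm (U x))" if x: "x \<in> l1_space" for x
    unfolding l1_norm_def
  proof (rule infsum_le_finite_sums[OF xsum[OF x]])
    fix A :: "'a set" assume A: "finite A"
    let ?G = "(\<lambda>\<alpha>. (\<alpha>, 0 :: nat)) ` A"
    \<comment> \<open>One factor \<open>K\<close> comes from passing to a partial sum, the second
      from recovering the l1 sum out of the block coordinates.\<close>
    have "norm (comb (coef (U x)) ?G i) \<le> K * sup_norm (U x)" for i
      unfolding K_def using A by (intro norm_comb_coef_le U_Z[OF x] norm_le_sup_norm Z_bounded) auto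
    then have "(\<Sum>b | b \<in> ?G \<and> snd b = 0. norm (coef (U x) b)) \<le> K * (real (Suc 0) * (K * sup_norm (U x)))"
      unfolding K_def using A by (intro l1_sum_le) auto
    moreover have "{b. b \<in> ?G \<and> snd b = 0} = ?G" by auto
    ultimately show "(\<Sum>\<alpha>\<in>A. norm (x \<alpha>)) \<le> K * (K * sup_norm (U x))"
      by (simp add: sum.reindex inj_on_def coef_U)
  qed
  have "bounded_linear_operator l1_space l1_norm Z sup_norm U"
    unfolding bounded_linear_operator_def
  proof (intro conjI ballI allI exI)
    show "sup_norm (U x) \<le> 1 * l1_norm x" if "x \<in> l1_space" for x
      using U_le[OF that] by (simp add: sup_norm_le)
    show "U (\<lambda>i. x i + y i) = (\<lambda>j. U x j + U y j)" if "x \<in> l1_space" "y \<in> l1_space" for x y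
      using infsum_add[OF summ[OF that(1)] summ[OF that(2)]]
      by (simp add: U_def fun_eq_iff distrib_right)
    show "U (\<lambda>i. c * x i) = (\<lambda>j. c * U x j)" for c x
      by (simp add: U_def fun_eq_iff mult.assoc infsum_cmult_right')
  qed (rule U_Z)
  moreover have "1 / (K * K) * l1_norm x \<le> sup_norm (U x)" if "x \<in> l1_space" for x
    using lower[OF that] \<open>K > 0\<close> by (simp add: field_simps)
  ultimately show ?thesis
    unfolding embeds_def using \<open>K > 0\<close>
    by (intro exI[of _ U] conjI exI[of _ "1 / (K * K)"]) auto
qed

end

section \<open>Indexing by the first uncountable ordinal\<close>

text \<open>The classical independent family: finitely many distinct sets \<open>r x\<close> already
  have distinct traces below some \<open>m\<close>, and listing the traces that come from
  \<open>Q\<close> singles out \<open>Q\<close>.\<close>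

lemma independent_family_exists:
  fixes r :: "'a \<Rightarrow> nat set"
  assumes "inj r"
  shows "\<exists>sel :: 'a \<Rightarrow> nat \<Rightarrow> bool.
    \<forall>F Q. finite F \<longrightarrow> Q \<subseteq> F \<longrightarrow> (\<exists>k. \<forall>x\<in>F. sel x k \<longleftrightarrow> x \<in> Q)"
proof -
  \<comment> \<open>Lists stand for finite sets so that the conditions \<open>(m, L)\<close> form a
    countable type, enumerated by \<open>from_nat\<close>.\<close>
  define sel' where "sel' x p = (case p of (m, L) \<Rightarrow> r x \<inter> {..<m} \<in> set (map set L))"
    for x and p :: "nat \<times> nat list list"
  have sel': "\<exists>p. \<forall>x\<in>F. sel' x p \<longleftrightarrow> x \<in> Q" if F: "finite F" "Q \<subseteq> F" for F Q
  proof -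
    have "\<exists>m. x = y \<or> (m \<in> r x \<longleftrightarrow> m \<notin> r y)" for x y
      using assms by (auto dest: injD)
    \<comment> \<open>\<open>w x y\<close> is a point where \<open>r x\<close> and
      \<open>r y\<close> differ; \<open>m\<close> is then taken above all of them.\<close>
    then obtain w where w: "\<And>x y. x = y \<or> (w x y \<in> r x \<longleftrightarrow> w x y \<notin> r y)" by metis
    have "finite (case_prod w ` (F \<times> F))" using F by simp
    then obtain m where m: "\<And>x y. x \<in> F \<Longrightarrow> y \<in> F \<Longrightarrow> w x y < m"
      unfolding finite_nat_set_iff_bounded by auto
    have inj: "x = y" if "x \<in> F" "y \<in> F" "r x \<inter> {..<m} = r y \<inter> {..<m}" for x y
      using w[of x y] m[OF that(1,2)] that(3) by blast
    have "finite Q" using F finite_subset by blast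
    then obtain qs where qs: "set qs = Q" using finite_list by blast
    define L where "L = map (\<lambda>x. sorted_list_of_set (r x \<inter> {..<m})) qs"
    have "set (map set L) = (\<lambda>x. r x \<inter> {..<m}) ` Q"
      by (auto simp: L_def qs image_iff)
    then have "sel' x (m, L) \<longleftrightarrow> (\<exists>y\<in>Q. r x \<inter> {..<m} = r y \<inter> {..<m})" for x
      by (simp add: sel'_def image_iff del: set_map)
    then have "\<forall>x\<in>F. sel' x (m, L) \<longleftrightarrow> x \<in> Q"
      using inj F(2) by blast
    then show ?thesis by blast
  qed
  have "\<exists>k. \<forall>x\<in>F. sel' x (from_nat k) \<longleftrightarrow> x \<in> Q" if "finite F" "Q \<subseteq> F" for F Q
    using sel'[OF that] by (metis from_nat_to_nat)
  then show ?thesis by (intro exI[of _ "\<lambda>x k. sel' x (from_nat k)"]) blast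
qed

text \<open>By Cantor the power set of \<open>nat\<close> exceeds \<open>natLeq\<close>, and
  \<open>cardSuc natLeq\<close> is the least cardinal that does.\<close>

lemma inj_omega1_nat_set:
  includes cardinal_syntax
  obtains r :: "omega1 \<Rightarrow> nat set" where "inj r"
proof -
  have "natLeq <o |UNIV :: nat set set|"
  proof -
    have "|UNIV :: nat set| <o |Pow (UNIV :: nat set)|" by (rule card_of_Pow)
    then show ?thesis
      using card_of_nat ordIso_ordLess_trans ordIso_symmetric by (metis Pow_UNIV)
  qed
  then have "cardSuc natLeq \<le>o |UNIV :: nat set set|"
    by (intro cardSuc_least natLeq_Card_order card_of_Card_order)
  moreover have "|Field (cardSuc natLeq)| =o cardSuc natLeq"
    by (rule card_of_Field_ordIso[OF cardSuc_Card_order[OF natLeq_Card_order]])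
  ultimately have "|Field (cardSuc natLeq)| \<le>o |UNIV :: nat set set|"
    by (rule ordIso_ordLeq_trans[rotated])
  then obtain h :: "_ \<Rightarrow> nat set" where "inj_on h (Field (cardSuc natLeq))"
    by (auto simp: card_of_ordLeq[symmetric])
  then have "inj (h \<circ> Rep_omega1)"
    by (intro inj_onI) (auto dest: inj_onD simp: Rep_omega1 Rep_omega1_inject)
  then show ?thesis by (rule that)
qed

text \<open>An infinite cardinal absorbs a product with \<open>nat\<close> and then a countable
  summand.\<close>

lemma bij_omega1_sum:
  includes cardinal_syntax
  obtains g :: "omega1 \<Rightarrow> (omega1 \<times> nat) + (nat \<times> nat)" where "bij g"
proof -
  let ?A = "UNIV :: omega1 set"
  have inf: "infinite ?A"
    using uncountable_omega1 countable_finite by blast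
  have nat_le: "|UNIV :: nat set| \<le>o |?A|"
    using inf infinite_iff_card_of_nat by blast
  have p: "|?A| =o |?A \<times> (UNIV :: nat set)|"
    using inf nat_le by (intro card_of_Times_infinite_simps) auto
  have "infinite (?A \<times> (UNIV :: nat set))"
    using inf finite_cartesian_productD1 by blast
  moreover have "|UNIV :: (nat \<times> nat) set| \<le>o |?A \<times> (UNIV :: nat set)|"
  proof -
    obtain h :: "nat \<Rightarrow> omega1" where "inj h"
      using infinite_countable_subset[OF inf] by blast
    then have "inj (map_prod h (id :: nat \<Rightarrow> nat))"
      by (simp add: prod.inj_map)
    then show ?thesis
      unfolding card_of_ordLeq[symmetric] by (metis UNIV_Times_UNIV subset_UNIV)
  qed
  ultimately have "|(?A \<times> (UNIV :: nat set)) <+> (UNIV :: (nat \<times> nat) set)| =o |?A \<times> (UNIV :: nat set)|"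
    by (rule card_of_Plus_infinite1)
  then have "|?A| =o |(?A \<times> (UNIV :: nat set)) <+> (UNIV :: (nat \<times> nat) set)|"
    using p ordIso_symmetric ordIso_transitive by blast
  then have "|?A| =o |UNIV :: ((omega1 \<times> nat) + (nat \<times> nat)) set|"
    by simp
  then obtain g :: "omega1 \<Rightarrow> (omega1 \<times> nat) + (nat \<times> nat)" where "bij g"
    unfolding card_of_ordIso[symmetric] by blast
  then show ?thesis by (rule that)
qed

text \<open>Stated for the sort shared by \<open>real\<close> and \<open>complex\<close>, so that
  one construction serves both scalar fields.\<close>

lemma unconditional_subspace_exists:
  "\<exists>Z :: (omega1 \<Rightarrow> 'k::{real_normed_field,euclidean_space}) set.
    closed_subspace_of Z linf_c_space sup_norm \<and>
    has_unconditional_basis Z sup_norm \<and>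
    \<not> embeds Z sup_norm (linf_space :: (nat \<Rightarrow> 'k) set) sup_norm \<and>
    \<not> embeds (c0_space :: (omega1 \<Rightarrow> 'k) set) sup_norm Z sup_norm \<and>
    embeds (l1_space :: (omega1 \<Rightarrow> 'k) set) l1_norm Z sup_norm \<and>
    (\<exists>T. bounded_linear_operator Z sup_norm (linf_space :: (nat \<Rightarrow> 'k) set) sup_norm T \<and>
         inj_on T Z)"
proof -
  obtain r :: "omega1 \<Rightarrow> nat set" where "inj r"
    by (rule inj_omega1_nat_set)
  then obtain sel :: "omega1 \<Rightarrow> nat \<Rightarrow> bool"
    where sel: "\<And>F Q. finite F \<Longrightarrow> Q \<subseteq> F \<Longrightarrow> \<exists>k. \<forall>x\<in>F. sel x k \<longleftrightarrow> x \<in> Q"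
    using independent_family_exists by metis
  obtain g :: "omega1 \<Rightarrow> (omega1 \<times> nat) + (nat \<times> nat)" where "bij g"
    by (rule bij_omega1_sum)
  then interpret weighted_l1_sum g sel
    by unfold_locales (use sel in auto)
  show ?thesis
    by (rule exI[of _ Z], intro conjI exI[of _ restr])
      (rule closed_subspace_Z unconditional_basis_Z not_embeds_Z_linf[OF uncountable_omega1]
        not_embeds_c0_Z[OF uncountable_omega1] embeds_l1_Z bounded_linear_operator_restr
        inj_on_restr)+
qed

theorem theorem2p4:
  shows "(\<exists>Z :: (omega1 \<Rightarrow> real) set.
        closed_subspace_of Z linf_c_space sup_norm \<and>
        has_unconditional_basis Z sup_norm \<and>
        \<not> embeds Z sup_norm (linf_space :: (nat \<Rightarrow> real) set) sup_norm \<and>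
        \<not> embeds (c0_space :: (omega1 \<Rightarrow> real) set) sup_norm Z sup_norm \<and>
        embeds (l1_space :: (omega1 \<Rightarrow> real) set) l1_norm Z sup_norm \<and>
        (\<exists>T. bounded_linear_operator Z sup_norm (linf_space :: (nat \<Rightarrow> real) set) sup_norm T \<and>
             inj_on T Z))
    \<and>
    (\<exists>Z :: (omega1 \<Rightarrow> complex) set.
        closed_subspace_of Z linf_c_space sup_norm \<and>
        has_unconditional_basis Z sup_norm \<and>
        \<not> embeds Z sup_norm (linf_space :: (nat \<Rightarrow> complex) set) sup_norm \<and>
        \<not> embeds (c0_space :: (omega1 \<Rightarrow> complex) set) sup_norm Z sup_norm \<and>
        embeds (l1_space :: (omega1 \<Rightarrow> complex) set) l1_norm Z sup_norm \<and>
        (\<exists>T. bounded_linear_operator Z sup_norm (linf_space :: (nat \<Rightarrow> complex) set) sup_norm T \<and>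
             inj_on T Z))"
  by (intro conjI unconditional_subspace_exists)

end
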